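(* Let $n\geq 5$. For every $j\in\mathbb{Z}$, the number of directed spanning trees of $\overrightarrow{C_n^2}$ rooted by $v_j$ is $t(\overrightarrow{C_n^2},v_j)=J_n$.
   Context: For $n\geq 5$, the directed square cycle $\overrightarrow{C_n^2}$ has vertex set $\mathbb{Z}_n$, with $v_i=i+n\mathbb{Z}$ for $i\in\mathbb{Z}$, and edge set $\{(v_i,v_{i+1}),(v_i,v_{i+2})\mid i\in\mathbb{Z}\}$. A directed spanning tree rooted by $u$ is a spanning subgraph whose underlying undirected graph is connected, which has no closed paths, in which every vertex $v\neq u$ has in-degree $1$, and in which every vertex $v\neq u$ is reachable from $u$ by a directed path; $t(\overrightarrow{G},u)$ is the number of such trees. The Jacobsthal sequence is $J_0=0$, $J_1=1$, $J_{m+2}=J_{m+1}+2J_m$ for $m\geq 0$. *)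

theory Defs
  imports "HOL-Algebra.IntRing" "Graph_Theory.Digraph_Component"
begin

(* ZMod n i is the coset i + nZ, and carrier (ZFact n) is the set of all such cosets. *)

definition directed_square_cycle :: "nat \<Rightarrow> (int set, int set \<times> int set) pre_digraph" where
  "directed_square_cycle n =
     \<lparr> verts = carrier (ZFact (int n)),
       arcs = (\<Union>i::int. {(ZMod (int n) i, ZMod (int n) (i + 1)),
                          (ZMod (int n) i, ZMod (int n) (i + 2))}),
       tail = fst,
       head = snd \<rparr>"

(* In Graph_Theory, spanning_tree T G says that T is a subgraph of G with the same vertices,
   that T is connected as an undirected graph (connected passes to the symmetric closure),
   and that T has no directed cycle (forest). *)

definition directed_spanning_tree ::
  "('a, 'b) pre_digraph \<Rightarrow> ('a, 'b) pre_digraph \<Rightarrow> 'a \<Rightarrow> bool" where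
  "directed_spanning_tree T G u \<longleftrightarrow>
     u \<in> verts G \<and> spanning_tree T G \<and>
     (\<forall>v \<in> verts T. v \<noteq> u \<longrightarrow> in_degree T v = 1) \<and>
     (\<forall>v \<in> verts T. v \<noteq> u \<longrightarrow> u \<rightarrow>\<^sup>*\<^bsub>T\<^esub> v)"

(* A subgraph has the same tail and head functions as G, so distinct T in this set differ in
   their arcs, and the set is finite whenever G is. *)

definition num_directed_spanning_trees :: "('a, 'b) pre_digraph \<Rightarrow> 'a \<Rightarrow> nat" where
  "num_directed_spanning_trees G u = card {T. directed_spanning_tree T G u}"

fun jacobsthal :: "nat \<Rightarrow> nat" where
  "jacobsthal 0 = 0"
| "jacobsthal (Suc 0) = 1"
| "jacobsthal (Suc (Suc m)) = jacobsthal (Suc m) + 2 * jacobsthal m"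

end

theory Submission
  imports Defs
begin

text \<open>
  Give the vertices the coordinates \<open>0, \<dots>, n - 1\<close> with the root at \<open>0\<close>. A rooted spanning tree
  is determined by the set \<open>S\<close> of the non-root vertices \<open>i\<close> whose parent is \<open>i - 2\<close> instead of
  \<open>i - 1\<close>. Conversely, a set \<open>S\<close> fails to give a tree exactly if the parent map has a cycle, and
  such a cycle must wind around: \<open>1\<close> has the parent \<open>n - 1\<close>, and the descent from \<open>n - 1\<close> stops at
  \<open>1\<close> rather than at the root. There are \<open>J\<^bsub>n - 1\<^esub>\<close> such sets, since the choices that make the
  descent from \<open>k\<close> stop at \<open>1\<close> satisfy the Jacobsthal recurrence (an element that is jumped over
  is free, whence the factor \<open>2\<close>). The result follows from \<open>J\<^bsub>n - 1\<^esub> + J\<^bsub>n\<^esub> = 2\<^bsup>n - 1\<^esup>\<close>.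
\<close>

section \<open>Rooted spanning trees without cycles\<close>

text \<open>A closed walk contains a cycle, so acyclicity can be treated by reachability
  alone.\<close>

lemma (in wf_digraph) forest_iff_no_reachable1: "forest G \<longleftrightarrow> (\<nexists>v. v \<rightarrow>\<^sup>+ v)"
proof
  assume "forest G"
  then show "\<nexists>v. v \<rightarrow>\<^sup>+ v"
    using closed_w_imp_cycle by (auto simp: forest_def closed_w_def reachable1_awalk)
next
  assume "\<nexists>v. v \<rightarrow>\<^sup>+ v"
  then show "forest G"
    by (auto simp: forest_def cycle_def reachable1_awalk)
qed

lemma (in wf_digraph) connected_if_reachable_from:
  assumes "u \<in> verts G" and "\<And>v. v \<in> verts G \<Longrightarrow> u \<rightarrow>\<^sup>* v"
  shows "connected G"
proof -
  interpret S: pair_wf_digraph "mk_symmetric G" ..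
  have u: "u \<rightarrow>\<^sup>*\<^bsub>mk_symmetric G\<^esub> v" if "v \<in> verts G" for v
    using that assms(2) reachable_mk_symmetricI by blast
  have "v \<rightarrow>\<^sup>*\<^bsub>mk_symmetric G\<^esub> w" if "v \<in> verts G" "w \<in> verts G" for v w
    using symmetric_reachable[OF symmetric_mk_symmetric u[OF that(1)]] u[OF that(2)]
    by (rule S.reachable_trans)
  then show ?thesis
    using assms(1) by (auto simp: connected_def strongly_connected_def)
qed

text \<open>Induction along the path from \<open>u\<close>: a closed walk through \<open>y\<close>
  enters \<open>y\<close> from its only predecessor \<open>x\<close>, hence also passes through
  \<open>x\<close>. Pushed back in this way it would reach \<open>u\<close>, which nothing
  enters.\<close>

lemma (in wf_digraph) no_reachable1_if_unique_predecessor: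
  assumes root: "\<And>x. \<not> x \<rightarrow> u"
    and unique: "\<And>x y v. x \<rightarrow> v \<Longrightarrow> y \<rightarrow> v \<Longrightarrow> x = y"
    and "u \<rightarrow>\<^sup>* v"
  shows "\<not> v \<rightarrow>\<^sup>+ v"
  using \<open>u \<rightarrow>\<^sup>* v\<close>
proof (induction rule: reachable_induct)
  case base
  show ?case using root by (meson tranclE)
next
  case (step x y)
  show ?case
  proof
    assume "y \<rightarrow>\<^sup>+ y"
    then obtain z where "y \<rightarrow>\<^sup>* z" "z \<rightarrow> y"
      by (metis adj_in_verts(1) reachable1_reachable reachable_refl tranclE)
    with unique[OF \<open>x \<rightarrow> y\<close>] have "y \<rightarrow>\<^sup>* x" by simp
    with \<open>x \<rightarrow> y\<close> have "x \<rightarrow>\<^sup>+ x"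
      by (meson reachable1_reachable_trans trancl.r_into_trancl)
    with step.IH show False by blast
  qed
qed

text \<open>Connectedness and acyclicity are traded for local conditions plus reachability. The
  definition leaves the in-degree of the root open, but an arc into \<open>u\<close> would close a
  cycle with the path from \<open>u\<close> to its tail.\<close>

lemma directed_spanning_tree_iff:
  "directed_spanning_tree T G u \<longleftrightarrow>
     u \<in> verts G \<and> spanning T G \<and> in_arcs T u = {} \<and>
     (\<forall>v \<in> verts T. v \<noteq> u \<longrightarrow> in_degree T v = 1) \<and> (\<forall>v \<in> verts T. u \<rightarrow>\<^sup>*\<^bsub>T\<^esub> v)"
  (is "?L \<longleftrightarrow> ?R")
proof (cases "u \<in> verts G \<and> spanning T G")
  case True
  then interpret wf_digraph T by (auto simp: spanning_def)
  have u: "u \<in> verts T" using True by (auto simp: spanning_def)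
  show ?thesis
  proof
    assume L: ?L
    then have reach: "u \<rightarrow>\<^sup>*\<^bsub>T\<^esub> v" if "v \<in> verts T" for v
      using that u by (cases "v = u") (auto simp: directed_spanning_tree_def)
    have "in_arcs T u = {}"
    proof (rule ccontr)
      assume "in_arcs T u \<noteq> {}"
      then obtain e where e: "e \<in> arcs T" "head T e = u" by (auto simp: in_arcs_def)
      then have "tail T e \<rightarrow>\<^bsub>T\<^esub> u" by (auto simp: arcs_ends_conv)
      with reach[OF tail_in_verts[OF e(1)]] have "u \<rightarrow>\<^sup>+\<^bsub>T\<^esub> u"
        by (meson reachable_reachable1_trans trancl.r_into_trancl)
      with L show False
        by (auto simp: directed_spanning_tree_def spanning_tree_def tree_def forest_iff_no_reachable1)
    qed
    with L True reach show ?R by (auto simp: directed_spanning_tree_def)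
  next
    assume R: ?R
    have "x = y" if "x \<rightarrow>\<^bsub>T\<^esub> v" "y \<rightarrow>\<^bsub>T\<^esub> v" for x y v
    proof -
      obtain e where e: "e \<in> in_arcs T v" "tail T e = x"
        using \<open>x \<rightarrow>\<^bsub>T\<^esub> v\<close> by (auto simp: in_arcs_def)
      obtain f where f: "f \<in> in_arcs T v" "tail T f = y"
        using \<open>y \<rightarrow>\<^bsub>T\<^esub> v\<close> by (auto simp: in_arcs_def)
      have "v \<in> verts T" "v \<noteq> u" using R e by (auto simp: in_arcs_def)
      with R have "card (in_arcs T v) = 1" by (simp add: in_degree_def)
      then obtain a where "in_arcs T v = {a}" by (rule card_1_singletonE)
      with e f show ?thesis by auto
    qed
    moreover have "\<not> x \<rightarrow>\<^bsub>T\<^esub> u" for x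
      using R by (auto simp: in_arcs_def)
    ultimately have "forest T"
      using no_reachable1_if_unique_predecessor R reachable1_in_verts
      by (metis forest_iff_no_reachable1)
    moreover have "connected T"
      using connected_if_reachable_from u R by blast
    ultimately show ?L
      using R by (auto simp: directed_spanning_tree_def spanning_tree_def tree_def)
  qed
qed (auto simp: directed_spanning_tree_def spanning_tree_def)

section \<open>Counting the descents that stop at one\<close>

text \<open>\<open>S\<close> is the set of numbers from which the descent jumps by two.\<close>

fun descends_to_one :: "nat set \<Rightarrow> nat \<Rightarrow> bool" where
  "descends_to_one S 0 \<longleftrightarrow> False"
| "descends_to_one S (Suc 0) \<longleftrightarrow> True"
| "descends_to_one S (Suc (Suc k)) \<longleftrightarrow>
     (if Suc (Suc k) \<in> S then descends_to_one S k else descends_to_one S (Suc k))"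

text \<open>The descent only tests its current position while that is at least 2, so changing the
  membership of 1 or of numbers above \<open>k\<close> has no effect.\<close>

lemma descends_to_one_cong:
  assumes "\<And>i. 2 \<le> i \<Longrightarrow> i \<le> k \<Longrightarrow> i \<in> S \<longleftrightarrow> i \<in> S'"
  shows "descends_to_one S k \<longleftrightarrow> descends_to_one S' k"
  using assms by (induction S k rule: descends_to_one.induct) simp_all

lemma descends_to_one_insert [simp]:
  "k < m \<Longrightarrow> descends_to_one (insert m S) k \<longleftrightarrow> descends_to_one S k"
  by (rule descends_to_one_cong) simp

lemma card_subsets_insert:
  assumes "finite A" "x \<notin> A"
  shows "card {S. S \<subseteq> insert x A \<and> P S} =
         card {S. S \<subseteq> A \<and> P S} + card {S. S \<subseteq> A \<and> P (insert x S)}"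
proof -
  have fin: "finite {S. S \<subseteq> A \<and> Q S}" for Q
    using assms by simp
  have inj: "inj_on (insert x) {S. S \<subseteq> A \<and> P (insert x S)}"
    using assms by (auto intro!: inj_onI)
  have "{S. S \<subseteq> insert x A \<and> P S} =
        {S. S \<subseteq> A \<and> P S} \<union> insert x ` {S. S \<subseteq> A \<and> P (insert x S)}"
  proof (intro Set.set_eqI iffI)
    fix S assume S: "S \<in> {S. S \<subseteq> insert x A \<and> P S}"
    show "S \<in> {S. S \<subseteq> A \<and> P S} \<union> insert x ` {S. S \<subseteq> A \<and> P (insert x S)}"
    proof (cases "x \<in> S")
      case True
      then have "insert x (S - {x}) = S" "S - {x} \<subseteq> A" using S by auto
      with S have "S - {x} \<in> {S. S \<subseteq> A \<and> P (insert x S)}" by simp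
      with \<open>insert x (S - {x}) = S\<close> show ?thesis by (metis UnI2 image_eqI)
    next
      case False
      with S have "S \<subseteq> A" by auto
      with S show ?thesis by simp
    qed
  qed auto
  moreover have "{S. S \<subseteq> A \<and> P S} \<inter> insert x ` {S. S \<subseteq> A \<and> P (insert x S)} = {}"
    using assms by auto
  ultimately show ?thesis
    using fin by (simp add: card_Un_disjoint card_image[OF inj])
qed

text \<open>Split on whether the top element lies in \<open>S\<close>: if not, the descent continues
  one below; if so, two below, and the number in between may be chosen freely.\<close>

lemma card_descends_to_one:
  "card {S. S \<subseteq> {2..k} \<and> descends_to_one S k} = jacobsthal k"
proof (induction k rule: jacobsthal.induct)
  case 2
  have "{S. S \<subseteq> {2..Suc 0} \<and> descends_to_one S (Suc 0)} = {{}}" by auto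
  then show ?case by simp
next
  case (3 k)
  have ivl: "{2..Suc (Suc k)} = insert (Suc (Suc k)) {2..Suc k}" by auto
  have "card {S. S \<subseteq> {2..Suc k} \<and> descends_to_one S k} = 2 * jacobsthal k"
  \<comment> \<open>For \<open>k = 0\<close> the skipped number 1 is outside the range and yields no
    factor 2, but both sides are 0.\<close>
  proof (cases k)
    case (Suc m)
    then have "{2..Suc k} = insert (Suc k) {2..k}" by auto
    then show ?thesis
      using "3.IH"(2) by (simp add: card_subsets_insert)
  qed simp
  moreover have "{S. S \<subseteq> {2..Suc k} \<and> descends_to_one S (Suc (Suc k))} =
        {S. S \<subseteq> {2..Suc k} \<and> descends_to_one S (Suc k)}"
    by auto
  ultimately show ?case
    using "3.IH"(1) by (simp add: ivl card_subsets_insert)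
qed simp

lemma jacobsthal_add_Suc: "jacobsthal k + jacobsthal (Suc k) = 2 ^ k"
  by (induction k rule: jacobsthal.induct) auto

text \<open>Complementary counting: the excluded sets all contain 1, which the descent ignores, so
  there are \<open>jacobsthal m\<close> of them among the \<open>2 ^ m\<close> subsets.\<close>

lemma card_not_descends_to_one:
  assumes "0 < m"
  shows "card {S. S \<subseteq> {1..m} \<and> \<not> (1 \<in> S \<and> descends_to_one S m)} = jacobsthal (Suc m)"
proof -
  have ivl: "{1..m} = insert 1 {2..m}" using assms by auto
  have ins: "descends_to_one (insert 1 S) m \<longleftrightarrow> descends_to_one S m" for S
    by (rule descends_to_one_cong) simp
  have "{S. S \<subseteq> {2..m} \<and> 1 \<in> S \<and> descends_to_one S m} = {}" by auto
  with ins have bad: "card {S. S \<subseteq> {1..m} \<and> 1 \<in> S \<and> descends_to_one S m} = jacobsthal m"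
    unfolding ivl by (subst card_subsets_insert) (auto simp: card_descends_to_one)
  have "{S. S \<subseteq> {1..m} \<and> \<not> (1 \<in> S \<and> descends_to_one S m)} =
        Pow {1..m} - {S. S \<subseteq> {1..m} \<and> 1 \<in> S \<and> descends_to_one S m}"
    by auto
  also have "card \<dots> = 2 ^ m - jacobsthal m"
    by (subst card_Diff_subset) (use bad in \<open>auto simp: card_Pow\<close>)
  finally show ?thesis
    using jacobsthal_add_Suc[of m] by simp
qed

section \<open>Trees in the directed square cycle\<close>

locale square_cycle =
  fixes n :: nat and j :: int
  assumes n: "n \<ge> 5"
begin

text \<open>Coordinates counted from the root; indices from \<open>n\<close> on are allowed and wrap
  around, as \<open>parent\<close> requires.\<close>

definition vtx :: "nat \<Rightarrow> int set" where
  "vtx i = ZMod (int n) (j + int i)"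

text \<open>The parent \<open>i - 2\<close> is written \<open>i + n - 2\<close> to avoid truncated subtraction at \<open>i = 1\<close>.\<close>

definition parent :: "nat set \<Rightarrow> nat \<Rightarrow> nat" where
  "parent S i = (if i \<in> S then i + n - 2 else i - 1)"

definition tree_of :: "nat set \<Rightarrow> (int set, int set \<times> int set) pre_digraph" where
  "tree_of S = \<lparr> verts = vtx ` {..<n}, arcs = (\<lambda>i. (vtx (parent S i), vtx i)) ` {1..<n},
                 tail = fst, head = snd \<rparr>"

lemma verts_tree_of [simp]: "verts (tree_of S) = vtx ` {..<n}"
  by (simp add: tree_of_def)

abbreviation "G \<equiv> directed_square_cycle n"

lemma vtx_eq_iff: "vtx i = vtx k \<longleftrightarrow> i mod n = k mod n"
proof -
  have "vtx i = vtx k \<longleftrightarrow> int n dvd (int i - int k)"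
    by (simp add: vtx_def ZMod_eq_mod mod_eq_dvd_iff)
  also have "\<dots> \<longleftrightarrow> int i mod int n = int k mod int n"
    by (simp add: mod_eq_dvd_iff)
  also have "\<dots> \<longleftrightarrow> i mod n = k mod n"
    by (metis of_nat_eq_iff of_nat_mod)
  finally show ?thesis .
qed

lemma ZMod_eq_vtx: "ZMod (int n) i = vtx (nat ((i - j) mod int n))"
  using n by (simp add: vtx_def ZMod_eq_mod mod_simps)

lemma range_ZMod: "range (ZMod (int n)) = vtx ` {..<n}"
proof
  show "range (ZMod (int n)) \<subseteq> vtx ` {..<n}"
  proof
    fix x assume "x \<in> range (ZMod (int n))"
    then obtain i where "x = vtx (nat ((i - j) mod int n))" by (auto simp: ZMod_eq_vtx)
    moreover have "nat ((i - j) mod int n) < n" using n by (simp add: nat_less_iff)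
    ultimately show "x \<in> vtx ` {..<n}" by blast
  qed
qed (auto simp: vtx_def)

lemma verts_G: "verts G = vtx ` {..<n}"
proof -
  have "carrier (ZFact (int n)) = range (ZMod (int n))"
    by (auto simp: ZFact_defs A_RCOSETS_def' ZMod_def)
  then show ?thesis by (simp add: directed_square_cycle_def range_ZMod)
qed

lemma in_arcs_G:
  assumes "1 \<le> i"
  shows "(x, vtx i) \<in> arcs G \<longleftrightarrow> x = vtx (i - 1) \<or> x = vtx (i + n - 2)"
proof -
  \<comment> \<open>Solves for the tail of an arc of step \<open>d\<close> into
    \<open>vtx i\<close>; below, \<open>d\<close> is 1 or 2.\<close>
  have *: "vtx i = ZMod (int n) (k + d) \<longleftrightarrow> ZMod (int n) k = ZMod (int n) (j + int i - d)" for k d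
    unfolding vtx_def ZMod_eq_mod mod_eq_dvd_iff
    by (subst dvd_minus_iff[symmetric]) (simp add: algebra_simps)
  have "(x, vtx i) \<in> arcs G \<longleftrightarrow>
        x = ZMod (int n) (j + int i - 1) \<or> x = ZMod (int n) (j + int i - 2)"
    by (auto simp: directed_square_cycle_def *)
  moreover have "ZMod (int n) (j + int i - 1) = vtx (i - 1)"
    using assms by (simp add: vtx_def of_nat_diff algebra_simps)
  moreover have "ZMod (int n) (j + int i - 2) = vtx (i + n - 2)"
    using n by (simp add: vtx_def ZMod_eq_mod of_nat_diff mod_eq_dvd_iff)
  ultimately show ?thesis by simp
qed

lemma wf_G: "wf_digraph G"
  by unfold_locales
    (auto simp: directed_square_cycle_def ZFact_defs A_RCOSETS_def' ZMod_def)

lemma parent_in_arcs_G: "1 \<le> i \<Longrightarrow> (vtx (parent S i), vtx i) \<in> arcs G"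
  by (simp add: parent_def in_arcs_G)

lemma vtx_in_verts: "vtx i \<in> vtx ` {..<n}"
  using range_ZMod by (metis rangeI vtx_def)

lemma spanning_tree_of: "spanning (tree_of S) G"
proof -
  have "wf_digraph (tree_of S)"
    by unfold_locales (auto simp: tree_of_def vtx_in_verts)
  then show ?thesis
    using wf_G
    by (auto simp: spanning_def subgraph_def compatible_def tree_of_def verts_G parent_in_arcs_G)
      (simp_all add: directed_square_cycle_def)
qed

text \<open>The indices differ by \<open>n - 1\<close>, which is not a multiple of \<open>n\<close>.
  Hence a tree remembers which parent was chosen.\<close>

lemma vtx_parents_distinct: "1 \<le> i \<Longrightarrow> vtx (i - 1) \<noteq> vtx (i + n - 2)"
proof
  assume "1 \<le> i" and "vtx (i - 1) = vtx (i + n - 2)"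
  then have "int n dvd int (i - 1) - int (i + n - 2)"
    by (metis vtx_eq_iff mod_eq_dvd_iff of_nat_mod)
  then have "int n dvd int n - 1"
    using \<open>1 \<le> i\<close> n by (subst dvd_minus_iff[symmetric]) (simp add: of_nat_diff)
  then show False using n zdvd_imp_le[of "int n" "int n - 1"] by simp
qed

lemma in_arcs_tree_of:
  assumes "i < n"
  shows "in_arcs (tree_of S) (vtx i) = (if i = 0 then {} else {(vtx (parent S i), vtx i)})"
proof -
  have "vtx k = vtx i \<longleftrightarrow> k = i" if "k < n" for k
    using assms that by (simp add: vtx_eq_iff)
  then have "in_arcs (tree_of S) (vtx i) = (\<lambda>k. (vtx (parent S k), vtx k)) ` {k \<in> {1..<n}. k = i}"
    by (auto simp: in_arcs_def tree_of_def)
  also have "{k \<in> {1..<n}. k = i} = (if i = 0 then {} else {i})"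
    using assms by auto
  finally show ?thesis by auto
qed

section \<open>Reachability from the root in terms of descents\<close>

lemma dominates_tree_of: "1 \<le> i \<Longrightarrow> i < n \<Longrightarrow> vtx (parent S i) \<rightarrow>\<^bsub>tree_of S\<^esub> vtx i"
  by (force simp: arcs_ends_conv tree_of_def)

lemma vtx_parent:
  assumes "2 \<le> i"
  shows "vtx (parent S i) = vtx (if i \<in> S then i - 2 else i - 1)"
proof -
  have "i + n - 2 = i - 2 + n" using assms by simp
  then show ?thesis by (simp add: parent_def vtx_eq_iff)
qed

lemma descends_to_one_step:
  "2 \<le> i \<Longrightarrow> descends_to_one S i \<longleftrightarrow> descends_to_one S (if i \<in> S then i - 2 else i - 1)"
  by (cases "(S, i)" rule: descends_to_one.cases) auto

text \<open>Each vertex is reachable from the point, 0 or 1, where its descent stops. It remains to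
  reach 1 from 0: by a direct arc, or through \<open>n - 1\<close>, whose descent then stops at
  0.\<close>

lemma reachable_tree_of:
  assumes good: "\<not> (1 \<in> S \<and> descends_to_one S (n - 1))" and "i < n"
  shows "vtx 0 \<rightarrow>\<^sup>*\<^bsub>tree_of S\<^esub> vtx i"
proof -
  interpret wf_digraph "tree_of S"
    using spanning_tree_of by (auto simp: spanning_def)
  have desc: "vtx (if descends_to_one S i then 1 else 0) \<rightarrow>\<^sup>*\<^bsub>tree_of S\<^esub> vtx i" if "i < n" for i
    using that
  proof (induction i rule: less_induct)
    case (less i)
    show ?case
    proof (cases "2 \<le> i")
      case True
      let ?k = "if i \<in> S then i - 2 else i - 1"
      have "vtx (if descends_to_one S ?k then 1 else 0) \<rightarrow>\<^sup>*\<^bsub>tree_of S\<^esub> vtx ?k"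
        using less True by simp
      moreover have "vtx ?k \<rightarrow>\<^bsub>tree_of S\<^esub> vtx i"
        using dominates_tree_of[of i S] True less.prems by (simp add: vtx_parent)
      ultimately show ?thesis
        unfolding descends_to_one_step[OF True, of S] by (rule reachable_adj_trans)
    next
      case False
      then have "i = 0 \<or> i = 1" by auto
      then show ?thesis using vtx_in_verts by auto
    qed
  qed
  have one: "vtx (parent S 1) \<rightarrow>\<^bsub>tree_of S\<^esub> vtx 1"
    using n by (intro dominates_tree_of) auto
  have "vtx 0 \<rightarrow>\<^sup>*\<^bsub>tree_of S\<^esub> vtx 1"
  proof (cases "1 \<in> S")
    case True
    then have "vtx 0 \<rightarrow>\<^sup>*\<^bsub>tree_of S\<^esub> vtx (parent S 1)"
      using good desc[of "n - 1"] n by (simp add: parent_def)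
    then show ?thesis using one by (rule reachable_adj_trans)
  next
    case False
    then show ?thesis using one by (simp add: parent_def)
  qed
  then show ?thesis
    using desc[OF \<open>i < n\<close>] by (cases "descends_to_one S i") (simp_all, rule reachable_trans)
qed

text \<open>
  If the descent from \<open>n - 1\<close> returns to \<open>1\<close>, the vertices descending to \<open>1\<close> are closed under
  taking parents and do not contain the root.
\<close>

lemma reachable_tree_of_imp_good:
  assumes "vtx 0 \<rightarrow>\<^sup>*\<^bsub>tree_of S\<^esub> vtx 1"
  shows "\<not> (1 \<in> S \<and> descends_to_one S (n - 1))"
proof
  assume bad: "1 \<in> S \<and> descends_to_one S (n - 1)"
  interpret wf_digraph "tree_of S"
    using spanning_tree_of by (auto simp: spanning_def)
  have vtx_less: "i = k" if "vtx i = vtx k" "i < n" "k < n" for i k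
    using that by (simp add: vtx_eq_iff)
  have closed: "\<exists>k<n. x = vtx k \<and> descends_to_one S k"
    if arc: "x \<rightarrow>\<^bsub>tree_of S\<^esub> vtx i" and i: "i < n" "descends_to_one S i" for x i
  proof -
    have "1 \<le> i" using i by (cases i) auto
    obtain k where "1 \<le> k" "k < n" "x = vtx (parent S k)" "vtx i = vtx k"
      using arc by (auto simp: arcs_ends_conv tree_of_def)
    then have x: "x = vtx (parent S i)"
      using i vtx_less by blast
    show ?thesis
    proof (cases "2 \<le> i")
      case True
      let ?k = "if i \<in> S then i - 2 else i - 1"
      have "?k < n" using i by auto
      moreover have "x = vtx ?k" using x vtx_parent[OF True] by simp
      moreover have "descends_to_one S ?k" using i descends_to_one_step[OF True] by simp
      ultimately show ?thesis by blast
    next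
      case False
      \<comment> \<open>The only wrap-around: since 1 lies in \<open>S\<close>, its parent is
        \<open>n - 1\<close>, which descends to 1 by \<open>bad\<close>.\<close>
      with \<open>1 \<le> i\<close> have "i = 1" by simp
      with x bad have "x = vtx (n - 1)" by (simp add: parent_def)
      then show ?thesis using bad n by (intro exI[of _ "n - 1"]) auto
    qed
  qed
  have "\<not> (\<exists>k<n. v = vtx k \<and> descends_to_one S k)" if "vtx 0 \<rightarrow>\<^sup>*\<^bsub>tree_of S\<^esub> v" for v
    using that
  proof (induction rule: reachable_induct)
    case base
    then show ?case using n vtx_less[of 0] by fastforce
  next
    case (step x y)
    then show ?case using closed by blast
  qed
  from this[OF assms] show False using n by force
qed

text \<open>The in-degrees are right for every \<open>S\<close>, so only reachability decides, and
  vertex 1 alone already detects a failure.\<close>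

lemma directed_spanning_tree_tree_of:
  assumes "S \<subseteq> {1..n - 1}"
  shows "directed_spanning_tree (tree_of S) G (vtx 0) \<longleftrightarrow>
         \<not> (1 \<in> S \<and> descends_to_one S (n - 1))"
proof
  assume "directed_spanning_tree (tree_of S) G (vtx 0)"
  then have "vtx 0 \<rightarrow>\<^sup>*\<^bsub>tree_of S\<^esub> vtx 1"
    using n by (simp add: directed_spanning_tree_iff tree_of_def)
  then show "\<not> (1 \<in> S \<and> descends_to_one S (n - 1))"
    by (rule reachable_tree_of_imp_good)
next
  assume good: "\<not> (1 \<in> S \<and> descends_to_one S (n - 1))"
  have "in_degree (tree_of S) (vtx i) = 1" if "i < n" "vtx i \<noteq> vtx 0" for i
    using that by (cases "i = 0") (simp_all add: in_degree_def in_arcs_tree_of)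
  moreover have "in_arcs (tree_of S) (vtx 0) = {}"
    using in_arcs_tree_of[of 0 S] n by simp
  ultimately show "directed_spanning_tree (tree_of S) G (vtx 0)"
    using vtx_in_verts spanning_tree_of reachable_tree_of[OF good]
    unfolding directed_spanning_tree_iff verts_G verts_tree_of by blast
qed

section \<open>Bijection between parent choices and trees\<close>

lemma inj_on_tree_of: "inj_on tree_of (Pow {1..n - 1})"
proof (rule inj_onI)
  fix S S' assume S: "S \<in> Pow {1..n - 1}" "S' \<in> Pow {1..n - 1}" and eq: "tree_of S = tree_of S'"
  have "i \<in> S \<longleftrightarrow> i \<in> S'" if i: "1 \<le> i" "i < n" for i
  proof -
    have "in_arcs (tree_of S) (vtx i) = in_arcs (tree_of S') (vtx i)"
      by (simp only: eq)
    then have "vtx (parent S i) = vtx (parent S' i)"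
      using i by (simp add: in_arcs_tree_of)
    then show ?thesis
      using vtx_parents_distinct[OF i(1)] by (auto simp: parent_def split: if_splits)
  qed
  moreover have "1 \<le> i \<and> i < n" if "i \<in> S \<union> S'" for i
  proof -
    have "i \<in> {1..n - 1}" using S that by blast
    then show ?thesis using n by auto
  qed
  ultimately show "S = S'" by blast
qed

lemma directed_spanning_tree_imp_tree_of:
  assumes "directed_spanning_tree T G (vtx 0)"
  shows "\<exists>S \<subseteq> {1..n - 1}. T = tree_of S"
proof -
  have T: "verts T = vtx ` {..<n}" "arcs T \<subseteq> arcs G" "tail T = fst" "head T = snd"
    and root: "in_arcs T (vtx 0) = {}"
    and deg: "\<And>v. v \<in> verts T \<Longrightarrow> v \<noteq> vtx 0 \<Longrightarrow> card (in_arcs T v) = 1"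
    using assms
    by (auto simp: directed_spanning_tree_iff spanning_def subgraph_def compatible_def
        verts_G in_degree_def)
      (simp_all add: directed_square_cycle_def)
  \<comment> \<open>The choice set is read off from the arcs of step 2.\<close>
  define S where "S = {i \<in> {1..n - 1}. (vtx (i + n - 2), vtx i) \<in> arcs T}"
  have arc: "(x, vtx i) \<in> arcs T \<longleftrightarrow> x = vtx (parent S i)" if i: "1 \<le> i" "i < n" for x i
  proof -
    have "vtx i \<noteq> vtx 0" using i by (simp add: vtx_eq_iff)
    then have "card (in_arcs T (vtx i)) = 1" using deg i T by simp
    then obtain e where e: "in_arcs T (vtx i) = {e}" by (auto simp: card_1_singleton_iff)
    then have "e \<in> arcs T" "snd e = vtx i" using T by (auto simp: in_arcs_def)
    then obtain y where y: "e = (y, vtx i)" by (cases e) auto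
    have *: "(x, vtx i) \<in> arcs T \<longleftrightarrow> x = y" for x
      using e y T by (auto simp: in_arcs_def set_eq_iff)
    then have "(y, vtx i) \<in> arcs G" using T(2) by blast
    then have "y = vtx (i - 1) \<or> y = vtx (i + n - 2)"
      by (simp only: in_arcs_G[OF i(1)])
    \<comment> \<open>By \<open>*\<close>, \<open>y\<close> is the only tail of an arc of
      \<open>T\<close> into \<open>vtx i\<close>, so membership in \<open>S\<close> tells which of
      the two candidates it is.\<close>
    moreover have "i \<in> S \<longleftrightarrow> vtx (i + n - 2) = y"
      using i by (simp add: S_def *) linarith
    ultimately have "y = vtx (parent S i)"
      by (auto simp: parent_def)
    with * show ?thesis by simp
  qed
  have "arcs T = (\<lambda>i. (vtx (parent S i), vtx i)) ` {1..<n}"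
  proof (intro Set.set_eqI iffI)
    fix e assume e: "e \<in> arcs T"
    interpret wf_digraph T
      using assms by (auto simp: directed_spanning_tree_iff spanning_def)
    have "snd e \<in> vtx ` {..<n}" using head_in_verts[OF e] T by simp
    then obtain x i where i: "i < n" and e_eq: "e = (x, vtx i)" by (cases e) auto
    have "i \<noteq> 0"
      using root e T e_eq by (auto simp: in_arcs_def)
    then have "x = vtx (parent S i)" using arc[of i x] e e_eq i by simp
    then show "e \<in> (\<lambda>i. (vtx (parent S i), vtx i)) ` {1..<n}"
      using i \<open>i \<noteq> 0\<close> e_eq by auto
  next
    fix e assume "e \<in> (\<lambda>i. (vtx (parent S i), vtx i)) ` {1..<n}"
    then show "e \<in> arcs T" using arc by auto
  qed
  then have "T = tree_of S" using T by (simp add: tree_of_def)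
  moreover have "S \<subseteq> {1..n - 1}" by (auto simp: S_def)
  ultimately show ?thesis by blast
qed

lemma num_directed_spanning_trees_G:
  "num_directed_spanning_trees G (vtx 0) = jacobsthal n"
proof -
  let ?good = "{S. S \<subseteq> {1..n - 1} \<and> \<not> (1 \<in> S \<and> descends_to_one S (n - 1))}"
  have "{T. directed_spanning_tree T G (vtx 0)} = tree_of ` ?good"
    using directed_spanning_tree_imp_tree_of directed_spanning_tree_tree_of by blast
  moreover have "inj_on tree_of ?good"
    by (rule inj_on_subset[OF inj_on_tree_of]) auto
  ultimately have "num_directed_spanning_trees G (vtx 0) = card ?good"
    by (simp add: num_directed_spanning_trees_def card_image)
  also have "\<dots> = jacobsthal n"
    \<comment> \<open>There are \<open>n - 1\<close> non-root vertices, and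
      \<open>Suc (n - 1)\<close> is \<open>n\<close>.\<close>
    using card_not_descends_to_one[of "n - 1"] n by simp
  finally show ?thesis .
qed

end

theorem theorem4p2:
  fixes n :: nat and j :: int
  assumes "n \<ge> 5"
  shows "num_directed_spanning_trees (directed_square_cycle n) (ZMod (int n) j) = jacobsthal n"
proof -
  interpret square_cycle n j
    using assms by unfold_locales
  have "vtx 0 = ZMod (int n) j"
    by (simp add: vtx_def)
  with num_directed_spanning_trees_G show ?thesis
    by (simp only:)
qed

end
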